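(* Let $\mathcal{H}$ be a Hilbert space and let $\mathcal{S},\mathcal{T}\subset\mathcal{H}$ be closed subspaces. Then $T=P_{\mathcal{S}}P_{\mathcal{T}}$ is S-decomposable if and only if there exist orthonormal bases $\{\psi_n: n\ge 1\}$ of $\mathcal{S}$ and $\{\xi_n: n\ge 1\}$ of $\mathcal{T}$ such that $\langle\xi_n,\psi_m\rangle=0$ if $n\neq m$. In such case, the numbers $|\langle\xi_n,\psi_n\rangle|$ are the singular values of $T$.
   Context: For a closed subspace $\mathcal{S}\subset\mathcal{H}$, $P_{\mathcal{S}}$ denotes the orthogonal projection onto $\mathcal{S}$. A bounded operator $T$ on $\mathcal{H}$ is called S-decomposable if it has a singular value (Schmidt) decomposition $T=\sum_{n\ge 1} s_n\langle\,\cdot\,,\xi_n\rangle\psi_n$, where $\{\xi_n: n\ge 1\}$ and $\{\psi_n: n\ge 1\}$ are orthonormal systems and $s_n>0$; the numbers $s_n$ are the singular values of $T$. Equivalently, $T^*T$ is diagonalizable.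
   Formalization: The bases of S and T may have different index sets of any cardinality (with a common set n≥1 the claim fails for S properly inside T, both infinite-dimensional), and only the nonzero numbers |⟨ξ_n,ψ_n⟩|, with n in both index sets, are the singular values, which are positive. *)

theory Defs
  imports "HOL-Analysis.Analysis"
begin

text \<open>
  A complex inner product space is presented as a \<^class>\<open>real_inner\<close> space with a compatible
  complex structure: the real inner product (and hence the norm and the topology) is the real part
  of the complex one. The complex inner product \<open>cinner\<close> is linear in its first argument and
  conjugate linear in its second.
\<close>

class complex_inner = real_inner +
  fixes scaleC :: "complex \<Rightarrow> 'a \<Rightarrow> 'a" (infixr \<open>*\<^sub>C\<close> 75)
    and cinner :: "'a \<Rightarrow> 'a \<Rightarrow> complex"
  assumes scaleC_add_right: "a *\<^sub>C (x + y) = a *\<^sub>C x + a *\<^sub>C y"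
    and scaleC_add_left: "(a + b) *\<^sub>C x = a *\<^sub>C x + b *\<^sub>C x"
    and scaleC_scaleC: "a *\<^sub>C b *\<^sub>C x = (a * b) *\<^sub>C x"
    and scaleC_of_real: "complex_of_real r *\<^sub>C x = r *\<^sub>R x"
    and cinner_commute: "cinner x y = cnj (cinner y x)"
    and cinner_add_left: "cinner (x + y) z = cinner x z + cinner y z"
    and cinner_scaleC_left: "cinner (a *\<^sub>C x) y = a * cinner x y"
    and Re_cinner: "Re (cinner x y) = inner x y"

class chilbert_space = complex_inner + complete_space

instantiation complex :: chilbert_space
begin

definition scaleC_complex :: "complex \<Rightarrow> complex \<Rightarrow> complex"
  where "scaleC_complex a x = a * x"

definition cinner_complex :: "complex \<Rightarrow> complex \<Rightarrow> complex"
  where "cinner_complex x y = x * cnj y"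

instance
  by standard
    (auto simp: scaleC_complex_def cinner_complex_def algebra_simps scaleR_conv_of_real
      inner_complex_def)

end

global_interpretation complex_vector:
  vector_space "scaleC :: complex \<Rightarrow> 'a \<Rightarrow> 'a::complex_inner"
  using scaleC_of_real[where r = 1]
  by unfold_locales (auto simp: scaleC_add_right scaleC_add_left scaleC_scaleC)

definition bounded_clinear :: "('a::complex_inner \<Rightarrow> 'b::complex_inner) \<Rightarrow> bool"
  where "bounded_clinear T \<longleftrightarrow> bounded_linear T \<and> (\<forall>c x. T (c *\<^sub>C x) = c *\<^sub>C T x)"

definition orthonormal_on :: "'i set \<Rightarrow> ('i \<Rightarrow> 'a::complex_inner) \<Rightarrow> bool"
  where "orthonormal_on I e \<longleftrightarrow>
    (\<forall>i\<in>I. \<forall>j\<in>I. cinner (e i) (e j) = (if i = j then 1 else 0))"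

text \<open>
  Two bases \<open>\<psi>\<close> and \<open>\<xi>\<close> with \<open>\<langle>\<xi> n, \<psi> m\<rangle> = 0\<close> for \<open>n \<noteq> m\<close> are indexed by two possibly different
  sets \<open>I\<close> and \<open>J\<close>: with \<open>{n. n \<ge> 1}\<close> for both, no such bases would exist even for
  infinite-dimensional \<open>S \<subset> T\<close>, where the product of the projections is that onto \<open>S\<close>. Under the
  orthogonality condition the \<open>\<xi> n\<close> together with the \<open>\<psi> n\<close> for \<open>n \<in> I - J\<close> are orthonormal, so
  \<open>I \<union> J\<close> embeds into the space.
\<close>

definition orthonormal_basis_of :: "'i set \<Rightarrow> ('i \<Rightarrow> 'a::complex_inner) \<Rightarrow> 'a set \<Rightarrow> bool"
  where "orthonormal_basis_of I e S \<longleftrightarrow>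
    orthonormal_on I e \<and> closure (complex_vector.span (e ` I)) = S"

text \<open>
  The orthogonal projection; the description is well defined when \<open>S\<close> is a closed subspace of a
  Hilbert space.
\<close>

definition proj :: "'a::complex_inner set \<Rightarrow> 'a \<Rightarrow> 'a"
  where "proj S x = (THE y. y \<in> S \<and> (\<forall>z\<in>S. cinner (x - y) z = 0))"

text \<open>
  \<open>schmidt_decomposition T K s \<xi> \<psi>\<close> says \<open>T = (\<Sum>n\<in>K. s n \<langle>\<cdot>, \<xi> n\<rangle> \<psi> n)\<close>. The series is taken
  pointwise (it does not converge in operator norm unless \<open>T\<close> is compact), and its terms are pairwise
  orthogonal, so the order of summation does not matter. An index set \<open>K\<close> of arbitrary cardinality
  replaces \<open>{n. n \<ge> 1}\<close>: it may be finite, and it may be uncountable if the space is not separable.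
\<close>

definition schmidt_decomposition ::
    "('a::complex_inner \<Rightarrow> 'a) \<Rightarrow> 'i set \<Rightarrow> ('i \<Rightarrow> real) \<Rightarrow> ('i \<Rightarrow> 'a) \<Rightarrow> ('i \<Rightarrow> 'a) \<Rightarrow> bool"
  where "schmidt_decomposition T K s \<xi> \<psi> \<longleftrightarrow>
    orthonormal_on K \<xi> \<and> orthonormal_on K \<psi> \<and> (\<forall>n\<in>K. s n > 0) \<and>
    (\<forall>x. ((\<lambda>n. (complex_of_real (s n) * cinner x (\<xi> n)) *\<^sub>C \<psi> n) has_sum T x) K)"

text \<open>
  Index sets are taken inside the space itself, which is a way of quantifying over index sets of
  any type: an orthonormal family is injective and so can be re-indexed by its own members. The
  lemmas \<open>S_decomposableI\<close> and \<open>S_decomposable_iff_nat\<close> below make this precise; by the latter,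
  subsets of \<open>nat\<close> suffice in a separable space.
\<close>

definition S_decomposable :: "('a::complex_inner \<Rightarrow> 'a) \<Rightarrow> bool"
  where "S_decomposable T \<longleftrightarrow>
    bounded_clinear T \<and> (\<exists>(K::'a set) s \<xi> \<psi>. schmidt_decomposition T K s \<xi> \<psi>)"

definition singular_values :: "('a::complex_inner \<Rightarrow> 'a) \<Rightarrow> real set"
  where "singular_values T =
    {\<sigma>. \<exists>(K::'a set) s \<xi> \<psi>. schmidt_decomposition T K s \<xi> \<psi> \<and> \<sigma> \<in> s ` K}"

lemma orthonormal_on_inj_on: "orthonormal_on I e \<Longrightarrow> inj_on e I"
  unfolding orthonormal_on_def inj_on_def by (metis zero_neq_one)

lemma schmidt_decomposition_reindex:
  assumes h: "bij_betw h L K" and D: "schmidt_decomposition T K s \<xi> \<psi>"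
  shows "schmidt_decomposition T L (s \<circ> h) (\<xi> \<circ> h) (\<psi> \<circ> h)"
proof -
  have hK: "h i \<in> K" if "i \<in> L" for i
    using h that by (auto simp: bij_betw_def)
  have hinj: "h i = h j \<longleftrightarrow> i = j" if "i \<in> L" "j \<in> L" for i j
    using h that by (auto simp: bij_betw_def inj_on_def)
  have "((\<lambda>n. (complex_of_real (s (h n)) * cinner x (\<xi> (h n))) *\<^sub>C \<psi> (h n)) has_sum T x) L" for x
    using D has_sum_reindex_bij_betw
        [OF h, where f = "\<lambda>n. (complex_of_real (s n) * cinner x (\<xi> n)) *\<^sub>C \<psi> n"]
    by (simp add: schmidt_decomposition_def)
  then show ?thesis
    using D unfolding schmidt_decomposition_def orthonormal_on_def by (auto simp: hK hinj)
qed

lemma S_decomposableI: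
  fixes K :: "'i set" and T :: "'a::complex_inner \<Rightarrow> 'a"
  assumes "bounded_clinear T" and D: "schmidt_decomposition T K s \<xi> \<psi>"
  shows "S_decomposable T"
proof -
  have "inj_on \<xi> K"
    using D orthonormal_on_inj_on by (auto simp: schmidt_decomposition_def)
  then have "bij_betw (inv_into K \<xi>) (\<xi> ` K) K"
    by (simp add: bij_betw_inv_into inj_on_imp_bij_betw)
  from schmidt_decomposition_reindex[OF this D] assms(1) show ?thesis
    unfolding S_decomposable_def by blast
qed

lemma orthonormal_on_countable:
  fixes e :: "'i \<Rightarrow> 'a::{complex_inner, second_countable_topology}"
  assumes e: "orthonormal_on I e"
  shows "countable I"
proof -
  have dist: "dist (e i) (e j) \<ge> 1" if "i \<in> I" "j \<in> I" "i \<noteq> j" for i j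
  proof -
    have "inner (e i) (e i) = 1" "inner (e j) (e j) = 1" "inner (e i) (e j) = 0"
      using e that by (auto simp: orthonormal_on_def simp flip: Re_cinner)
    then have "(dist (e i) (e j))\<^sup>2 = 2"
      by (simp add: dist_norm power2_norm_eq_inner inner_diff_left inner_diff_right inner_commute)
    then show ?thesis
      by (simp add: power2_le_imp_le[of 1])
  qed
  let ?F = "(\<lambda>i. ball (e i) (1/2)) ` I"
  have disj: "ball (e i) (1/2) \<inter> ball (e j) (1/2) = {}" if "i \<in> I" "j \<in> I" "i \<noteq> j" for i j
  proof (rule ccontr)
    assume "\<not> ?thesis"
    then obtain x where "dist (e i) x < 1/2" "dist (e j) x < 1/2" by auto
    then show False using dist[OF that] dist_triangle2[of "e i" "e j" x] by linarith
  qed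
  have "pairwise disjnt ?F"
    unfolding pairwise_image using disj by (auto simp: pairwise_def disjnt_def simp del: mem_ball)
  then have "countable ?F"
    by (intro countable_disjoint_open_subsets) auto
  moreover have "inj_on (\<lambda>i. ball (e i) (1/2)) I"
  proof (rule inj_onI, rule ccontr)
    fix i j assume "i \<in> I" "j \<in> I" "ball (e i) (1/2) = ball (e j) (1/2)" "i \<noteq> j"
    with disj[of i j] have "ball (e i) (1/2) = {}" by simp
    then show False by simp
  qed
  ultimately show ?thesis
    using countable_image_inj_on by blast
qed

lemma S_decomposable_iff_nat:
  fixes T :: "'a::{complex_inner, second_countable_topology} \<Rightarrow> 'a"
  shows "S_decomposable T \<longleftrightarrow>
    bounded_clinear T \<and> (\<exists>(K::nat set) s \<xi> \<psi>. schmidt_decomposition T K s \<xi> \<psi>)"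
proof
  assume "S_decomposable T"
  then obtain K :: "'a set" and s \<xi> \<psi>
    where T: "bounded_clinear T" and D: "schmidt_decomposition T K s \<xi> \<psi>"
    by (auto simp: S_decomposable_def)
  have "countable K"
    using D orthonormal_on_countable by (auto simp: schmidt_decomposition_def)
  then have "bij_betw (inv_into K (to_nat_on K)) (to_nat_on K ` K) K"
    by (simp add: bij_betw_inv_into inj_on_imp_bij_betw inj_on_to_nat_on)
  from schmidt_decomposition_reindex[OF this D] T
  show "bounded_clinear T \<and> (\<exists>(K::nat set) s \<xi> \<psi>. schmidt_decomposition T K s \<xi> \<psi>)"
    by blast
qed (blast intro: S_decomposableI)

end

theory Submission
  imports Defs
begin

text \<open>
  A Schmidt decomposition of \<open>P\<^sub>S P\<^sub>T\<close> has \<open>\<xi> n \<in> T\<close> and \<open>\<psi> n \<in> S\<close>, hence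
  \<open>\<langle>\<xi> n, \<psi> m\<rangle> = \<langle>P\<^sub>S P\<^sub>T \<xi> n, \<psi> m\<rangle> = s n \<delta>\<^sub>n\<^sub>m\<close>. Vectors of \<open>T\<close> orthogonal to all \<open>\<xi> n\<close> lie in the kernel, so
  are orthogonal to \<open>S\<close>; likewise vectors of \<open>S\<close> orthogonal to all \<open>\<psi> n\<close> are orthogonal to \<open>T\<close>. So any
  extension of the two systems to bases of \<open>T\<close> and \<open>S\<close> stays biorthogonal. Conversely, expanding both
  projections in biorthogonal bases gives \<open>P\<^sub>S P\<^sub>T x = \<Sum>n. \<langle>x, \<xi> n\<rangle> \<langle>\<xi> n, \<psi> n\<rangle> \<psi> n\<close>, which is a Schmidt
  decomposition once the phases of \<open>\<langle>\<xi> n, \<psi> n\<rangle>\<close> are absorbed into the \<open>\<psi> n\<close>.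
\<close>

section \<open>Algebra, norm and continuity of the complex inner product\<close>

lemma cinner_zero_left [simp]: "cinner 0 x = 0"
  using cinner_add_left[of 0 0 x] by simp

lemma cinner_zero_right [simp]: "cinner x 0 = 0"
  using cinner_commute[of x 0] by simp

lemma cinner_add_right: "cinner x (y + z) = cinner x y + cinner x z"
  by (metis cinner_add_left cinner_commute complex_cnj_add)

lemma cinner_diff_left: "cinner (x - y) z = cinner x z - cinner y z"
  by (metis add_diff_cancel_right' cinner_add_left diff_add_cancel)

lemma cinner_diff_right: "cinner x (y - z) = cinner x y - cinner x z"
  by (metis add_diff_cancel_right' cinner_add_right diff_add_cancel)

lemma cinner_scaleC_right: "cinner x (c *\<^sub>C y) = cnj c * cinner x y"
  by (metis cinner_commute cinner_scaleC_left complex_cnj_mult)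

lemma cinner_sum_left: "cinner (sum f A) z = (\<Sum>i\<in>A. cinner (f i) z)"
  by (induction A rule: infinite_finite_induct) (auto simp: cinner_add_left)

lemma cinner_eq_0_commute: "cinner x y = 0 \<longleftrightarrow> cinner y x = 0"
  by (metis cinner_commute complex_cnj_zero)

lemma cinner_self: "cinner x x = complex_of_real ((norm x)\<^sup>2)"
proof (rule complex_eqI)
  show "Re (cinner x x) = Re (complex_of_real ((norm x)\<^sup>2))"
    by (simp add: Re_cinner power2_norm_eq_inner)
  show "Im (cinner x x) = Im (complex_of_real ((norm x)\<^sup>2))"
    using arg_cong[OF cinner_commute[of x x], of Im] by simp
qed

lemma cinner_self_eq_0 [simp]: "cinner x x = 0 \<longleftrightarrow> x = 0"
  by (simp add: cinner_self)

lemma norm_scaleC: "norm (c *\<^sub>C x) = cmod c * norm x"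
proof -
  have "complex_of_real ((norm (c *\<^sub>C x))\<^sup>2) = complex_of_real ((cmod c * norm x)\<^sup>2)"
    unfolding cinner_self[symmetric] cinner_scaleC_left cinner_scaleC_right
    by (simp add: cinner_self power_mult_distrib complex_norm_square mult.assoc[symmetric]
        del: of_real_power)
  then have "(norm (c *\<^sub>C x))\<^sup>2 = (cmod c * norm x)\<^sup>2"
    unfolding of_real_eq_iff .
  then show ?thesis by (rule power2_eq_imp_eq) auto
qed

text \<open>Reduction to the real Cauchy-Schwarz inequality: multiplying \<open>x\<close> by a
  suitable unit phase \<open>c\<close> makes the inner product real and nonnegative, so that it
  coincides with the real inner product, while the norm of \<open>x\<close> is unchanged.\<close>

lemma cmod_cinner_le: "cmod (cinner x y) \<le> norm x * norm y"
proof (cases "cinner x y = 0")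
  case False
  define c where "c = cnj (cinner x y) / cmod (cinner x y)"
  have c: "cmod c = 1"
    using False by (simp add: c_def norm_divide)
  have "cinner (c *\<^sub>C x) y = cmod (cinner x y)"
    using False by (simp add: c_def cinner_scaleC_left complex_norm_square[symmetric]
        mult.commute[of "cnj _"] power2_eq_square)
  then have "cmod (cinner x y) = inner (c *\<^sub>C x) y"
    by (simp flip: Re_cinner)
  also have "\<dots> \<le> norm (c *\<^sub>C x) * norm y"
    by (rule norm_cauchy_schwarz)
  finally show ?thesis
    by (simp add: norm_scaleC c)
qed simp

lemma bounded_linear_cinner_left: "bounded_linear (\<lambda>x. cinner x y)"
proof (rule bounded_linear_intro)
  show "cinner (r *\<^sub>R x) y = r *\<^sub>R cinner x y" for r x
    by (subst scaleC_of_real[symmetric]) (simp add: cinner_scaleC_left scaleR_conv_of_real)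
qed (rule cinner_add_left, rule cmod_cinner_le)

lemma bounded_linear_scaleC: "bounded_linear (\<lambda>x. c *\<^sub>C x)"
proof (rule bounded_linear_intro)
  show "c *\<^sub>C r *\<^sub>R x = r *\<^sub>R c *\<^sub>C x" for r and x :: 'a
    by (simp add: scaleC_scaleC mult.commute flip: scaleC_of_real)
  show "norm (c *\<^sub>C x) \<le> norm x * cmod c" for x :: 'a
    by (simp add: norm_scaleC)
qed (rule scaleC_add_right)

lemma norm_add_orthogonal:
  assumes "cinner x y = 0"
  shows "(norm (x + y))\<^sup>2 = (norm x)\<^sup>2 + (norm y)\<^sup>2"
proof -
  have "inner x y = 0" using assms by (simp flip: Re_cinner)
  then show ?thesis
    by (simp add: power2_norm_eq_inner inner_add_left inner_add_right inner_commute)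
qed

section \<open>Orthogonality and closures of subspaces\<close>

lemma subspace_orthogonal: "complex_vector.subspace {y. cinner y x = 0}"
  by (auto simp: complex_vector.subspace_def cinner_add_left cinner_scaleC_left)

lemma closed_orthogonal: "closed {y. cinner y x = 0}"
  by (intro closed_Collect_eq linear_continuous_on bounded_linear_cinner_left continuous_on_const)

text \<open>The vectors orthogonal to \<open>x\<close> form a closed subspace; once it contains
  \<open>B\<close> it contains the closed span of \<open>B\<close>.\<close>

lemma orthogonal_closure_span:
  assumes "y \<in> closure (complex_vector.span B)" and "\<And>b. b \<in> B \<Longrightarrow> cinner b x = 0"
  shows "cinner y x = 0"
proof -
  have "complex_vector.span B \<subseteq> {y. cinner y x = 0}"
    using assms(2) by (intro complex_vector.span_minimal subspace_orthogonal) auto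
  then show ?thesis
    using assms(1) closure_minimal[OF _ closed_orthogonal] by auto
qed

lemma subspace_closure:
  assumes "complex_vector.subspace S"
  shows "complex_vector.subspace (closure S)"
proof (rule complex_vector.subspaceI)
  show "0 \<in> closure S"
    using assms closure_subset complex_vector.subspace_0 by blast
next
  fix x y assume "x \<in> closure S" "y \<in> closure S"
  then obtain f g where "\<And>n. f n \<in> S" "f \<longlonglongrightarrow> x" "\<And>n. g n \<in> S" "g \<longlonglongrightarrow> y"
    unfolding closure_sequential by blast
  then show "x + y \<in> closure S"
    unfolding closure_sequential using assms
    by (intro exI[of _ "\<lambda>n. f n + g n"]) (auto intro: tendsto_add complex_vector.subspace_add)
next
  fix c x assume "x \<in> closure S"
  then obtain f where "\<And>n. f n \<in> S" "f \<longlonglongrightarrow> x"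
    unfolding closure_sequential by blast
  then show "c *\<^sub>C x \<in> closure S"
    unfolding closure_sequential using assms
    by (intro exI[of _ "\<lambda>n. c *\<^sub>C f n"])
      (auto intro: bounded_linear.tendsto[OF bounded_linear_scaleC] complex_vector.subspace_scale)
qed

lemma subspace_scaleR:
  assumes "complex_vector.subspace S" and "x \<in> S"
  shows "r *\<^sub>R x \<in> S"
  using complex_vector.subspace_scale[OF assms, of "complex_of_real r"]
  by (simp add: scaleC_of_real)

section \<open>Nearest points and orthogonal projections\<close>

lemma nearest_point_exists:
  fixes S :: "'a::{real_inner, complete_space} set"
  assumes "convex S" and "closed S" and "S \<noteq> {}"
  obtains y where "y \<in> S" and "\<And>z. z \<in> S \<Longrightarrow> dist x y \<le> dist x z"
proof -
  define d where "d = infdist x S"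
  have d: "d \<le> dist x z" if "z \<in> S" for z
    using that by (simp add: d_def infdist_le)
  have d0: "d \<ge> 0" by (simp add: d_def infdist_nonneg)
  \<comment> \<open>A minimizing sequence. The slack is put on the squared distance so that it
    enters the parallelogram law linearly.\<close>
  have "\<exists>z\<in>S. (dist x z)\<^sup>2 < d\<^sup>2 + 1 / Suc n" for n
  proof (rule ccontr)
    assume "\<not> ?thesis"
    then have "sqrt (d\<^sup>2 + 1 / Suc n) \<le> dist x z" if "z \<in> S" for z
      using that by (intro real_le_lsqrt) (auto simp: not_less)
    then have "sqrt (d\<^sup>2 + 1 / Suc n) \<le> d"
      using assms(3) by (auto simp: d_def infdist_def intro!: cINF_greatest)
    then have "d\<^sup>2 + 1 / Suc n \<le> d\<^sup>2"
      using d0 sqrt_le_D by blast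
    then show False by simp
  qed
  then obtain f where f: "\<And>n. f n \<in> S" and fd: "\<And>n. (dist x (f n))\<^sup>2 < d\<^sup>2 + 1 / Suc n"
    by metis
  \<comment> \<open>Parallelogram law for \<open>a\<close> and \<open>b\<close>: by convexity the
    midpoint of \<open>f m\<close> and \<open>f n\<close> lies in \<open>S\<close>, so
    \<open>norm (a + b)\<close> is at least \<open>2 * d\<close>, which leaves only the two slacks
    to bound \<open>norm (a - b)\<close>.\<close>
  have near: "(dist (f m) (f n))\<^sup>2 \<le> 2 / Suc m + 2 / Suc n" for m n
  proof -
    define a b where "a = x - f m" and "b = x - f n"
    have mid: "(1/2) *\<^sub>R f m + (1/2) *\<^sub>R f n \<in> S"
      using f assms(1) by (auto intro!: convexD)
    have "a + b = 2 *\<^sub>R (x - ((1/2) *\<^sub>R f m + (1/2) *\<^sub>R f n))"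
      by (simp add: a_def b_def algebra_simps scaleR_2)
    then have "norm (a + b) = 2 * dist x ((1/2) *\<^sub>R f m + (1/2) *\<^sub>R f n)"
      by (simp add: dist_norm)
    then have "2 * d \<le> norm (a + b)"
      using d[OF mid] by simp
    then have "4 * d\<^sup>2 \<le> (norm (a + b))\<^sup>2"
      using d0 power_mono[of "2 * d" "norm (a + b)" 2] by (simp add: power_mult_distrib)
    moreover have "(norm (a + b))\<^sup>2 + (norm (a - b))\<^sup>2 = 2 * (norm a)\<^sup>2 + 2 * (norm b)\<^sup>2"
      by (simp add: power2_norm_eq_inner inner_add_left inner_add_right inner_diff_left
          inner_diff_right)
    moreover have "dist (f m) (f n) = norm (a - b)"
      by (simp add: a_def b_def dist_norm norm_minus_commute)
    moreover have "(norm a)\<^sup>2 < d\<^sup>2 + 1 / Suc m" "(norm b)\<^sup>2 < d\<^sup>2 + 1 / Suc n"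
      using fd[of m] fd[of n] by (simp_all add: a_def b_def dist_norm)
    moreover have "2 / Suc m = 2 * (1 / Suc m)" "2 / Suc n = 2 * (1 / Suc n)"
      by simp_all
    ultimately show ?thesis by (simp only:)
  qed
  have "Cauchy f"
  proof (rule metric_CauchyI)
    fix e :: real assume e: "0 < e"
    then obtain N where N: "1 / Suc N < e\<^sup>2 / 4"
      using nat_approx_posE[of "e\<^sup>2 / 4"] by auto
    have "dist (f m) (f n) < e" if "m \<ge> N" "n \<ge> N" for m n
    proof -
      have "2 / Suc m \<le> 2 / Suc N" "2 / Suc n \<le> 2 / Suc N"
        using that by (auto intro!: divide_left_mono)
      then have "(dist (f m) (f n))\<^sup>2 < e\<^sup>2"
        using near[of m n] N by simp
      then show ?thesis using e by (simp add: power_less_imp_less_base)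
    qed
    then show "\<exists>M. \<forall>m\<ge>M. \<forall>n\<ge>M. dist (f m) (f n) < e" by blast
  qed
  then obtain y where y: "f \<longlonglongrightarrow> y"
    using Cauchy_convergent convergent_def by blast
  have "(\<lambda>n. (dist x (f n))\<^sup>2) \<longlonglongrightarrow> (dist x y)\<^sup>2"
    by (intro tendsto_intros y)
  moreover have "(\<lambda>n. d\<^sup>2 + 1 / Suc n) \<longlonglongrightarrow> d\<^sup>2 + 0"
    by (intro tendsto_add tendsto_const LIMSEQ_Suc[OF lim_1_over_n])
  ultimately have "(dist x y)\<^sup>2 \<le> d\<^sup>2 + 0"
    using fd by (intro LIMSEQ_le) (auto intro: less_imp_le)
  then have "dist x y \<le> d"
    using d0 power2_le_imp_le by simp
  then show thesis
    using that closed_sequentially[OF assms(2) f y] d order_trans by blast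
qed

text \<open>Here \<open>c *\<^sub>C z\<close> is the component of \<open>x - y\<close> along
  \<open>z\<close>. Moving from \<open>y\<close> to \<open>y + c *\<^sub>C z\<close> stays in
  \<open>S\<close> and, by Pythagoras, lowers the squared distance by that of the component, so
  minimality forces the component to vanish.\<close>

lemma nearest_point_orthogonal:
  assumes S: "complex_vector.subspace S" and y: "y \<in> S"
    and near: "\<And>z. z \<in> S \<Longrightarrow> dist x y \<le> dist x z" and z: "z \<in> S"
  shows "cinner (x - y) z = 0"
proof (cases "z = 0")
  case False
  define c where "c = cinner (x - y) z / cinner z z"
  have orth: "cinner (x - y - c *\<^sub>C z) (c *\<^sub>C z) = 0"
    using False by (simp add: c_def cinner_diff_left cinner_scaleC_left cinner_scaleC_right)
  have "y + c *\<^sub>C z \<in> S"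
    using S y z by (simp add: complex_vector.subspace_add complex_vector.subspace_scale)
  from near[OF this] have "(norm (x - y))\<^sup>2 \<le> (norm (x - y - c *\<^sub>C z))\<^sup>2"
    by (simp add: dist_norm diff_diff_eq)
  moreover have "(norm (x - y))\<^sup>2 = (norm (x - y - c *\<^sub>C z))\<^sup>2 + (norm (c *\<^sub>C z))\<^sup>2"
    using norm_add_orthogonal[OF orth] by simp
  ultimately have "(norm (c *\<^sub>C z))\<^sup>2 \<le> 0"
    by linarith
  then have "norm (c *\<^sub>C z) = 0"
    by simp
  then show ?thesis
    using False by (auto simp: c_def norm_scaleC)
qed simp

text \<open>Resolves the description in \<open>proj\<close>: two candidates differ by a vector of
  \<open>S\<close>, and subtracting their orthogonality relations shows that this difference is
  orthogonal to itself.\<close>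

lemma proj_eqI:
  assumes S: "complex_vector.subspace S" and y: "y \<in> S"
    and orth: "\<And>z. z \<in> S \<Longrightarrow> cinner (x - y) z = 0"
  shows "proj S x = y"
  unfolding proj_def
proof (rule the_equality)
  fix y' assume y': "y' \<in> S \<and> (\<forall>z\<in>S. cinner (x - y') z = 0)"
  then have "y' - y \<in> S"
    using S y by (simp add: complex_vector.subspace_diff)
  then have "cinner (x - y) (y' - y) - cinner (x - y') (y' - y) = 0"
    using y' orth by simp
  then have "cinner (y' - y) (y' - y) = 0"
    by (simp flip: cinner_diff_left)
  then show "y' = y" by simp
qed (use y orth in auto)

text \<open>A locale, so that the projection facts can be instantiated for the two given subspaces
  and also for the closed span that arises when an orthonormal set is extended.\<close>

locale closed_csubspace =
  fixes S :: "'a::chilbert_space set"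
  assumes subspace: "complex_vector.subspace S" and closed: "closed S"
begin

lemma proj_props: "proj S x \<in> S \<and> (\<forall>z\<in>S. cinner (x - proj S x) z = 0)"
proof -
  have "convex S"
    unfolding convex_def
    by (auto intro: complex_vector.subspace_add[OF subspace] subspace_scaleR[OF subspace])
  moreover have "S \<noteq> {}"
    using complex_vector.subspace_0[OF subspace] by blast
  ultimately obtain y where y: "y \<in> S" "\<And>z. z \<in> S \<Longrightarrow> dist x y \<le> dist x z"
    using nearest_point_exists[OF _ closed] by blast
  note orth = nearest_point_orthogonal[OF subspace y]
  then show ?thesis
    using proj_eqI[OF subspace y(1) orth] y(1) by simp
qed

lemma proj_in: "proj S x \<in> S"
  using proj_props by blast

lemma proj_orthogonal: "z \<in> S \<Longrightarrow> cinner (x - proj S x) z = 0"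
  using proj_props by blast

lemma cinner_proj: "z \<in> S \<Longrightarrow> cinner (proj S x) z = cinner x z"
  using proj_orthogonal[of z x] by (simp add: cinner_diff_left)

lemma proj_id: "x \<in> S \<Longrightarrow> proj S x = x"
  by (rule proj_eqI[OF subspace]) auto

lemma proj_eq_0_iff: "proj S x = 0 \<longleftrightarrow> (\<forall>z\<in>S. cinner x z = 0)"
proof
  assume "proj S x = 0"
  then show "\<forall>z\<in>S. cinner x z = 0"
    using cinner_proj[of _ x] by simp
next
  assume "\<forall>z\<in>S. cinner x z = 0"
  then show "proj S x = 0"
    using complex_vector.subspace_0[OF subspace] by (intro proj_eqI[OF subspace]) auto
qed

lemma bounded_clinear_proj: "bounded_clinear (proj S)"
proof -
  have add: "proj S (x + y) = proj S x + proj S y" for x y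
    by (rule proj_eqI[OF subspace])
      (auto simp: cinner_add_left cinner_diff_left cinner_proj
        intro: complex_vector.subspace_add[OF subspace] proj_in)
  have scale: "proj S (c *\<^sub>C x) = c *\<^sub>C proj S x" for c x
    by (rule proj_eqI[OF subspace])
      (auto simp: cinner_scaleC_left cinner_diff_left cinner_proj
        intro: complex_vector.subspace_scale[OF subspace] proj_in)
  have "norm (proj S x) \<le> norm x" for x
  proof -
    have "(norm x)\<^sup>2 = (norm (x - proj S x))\<^sup>2 + (norm (proj S x))\<^sup>2"
      using norm_add_orthogonal[OF proj_orthogonal[OF proj_in, of x x]] by simp
    then show ?thesis by - (rule power2_le_imp_le, auto)
  qed
  moreover have "proj S (r *\<^sub>R x) = r *\<^sub>R proj S x" for r x
    using scale[of "complex_of_real r" x] by (simp only: scaleC_of_real)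
  ultimately have "bounded_linear (proj S)"
    by (intro bounded_linear_intro[where K = 1]) (simp_all add: add)
  then show ?thesis
    using scale by (simp add: bounded_clinear_def)
qed

end

section \<open>Orthonormal bases: expansion and extension\<close>

lemma orthonormal_basis_of_in:
  assumes "orthonormal_basis_of I e S" and "i \<in> I"
  shows "e i \<in> S"
proof -
  have "e i \<in> complex_vector.span (e ` I)"
    using assms(2) by (intro complex_vector.span_base imageI)
  then show ?thesis
    using assms(1) closure_subset unfolding orthonormal_basis_of_def by fast
qed

text \<open>Pythagoras: the Fourier sum \<open>p\<close> leaves a remainder \<open>x - p\<close>
  orthogonal to the span, which contains \<open>p - y\<close>.\<close>

lemma orthonormal_partial_sum_best:
  assumes e: "orthonormal_on I e" and F: "finite F" "F \<subseteq> I"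
    and y: "y \<in> complex_vector.span (e ` F)"
  shows "norm (x - (\<Sum>i\<in>F. cinner x (e i) *\<^sub>C e i)) \<le> norm (x - y)"
proof -
  define p where "p = (\<Sum>i\<in>F. cinner x (e i) *\<^sub>C e i)"
  have "cinner (e j) (x - p) = 0" if j: "j \<in> F" for j
  proof -
    have "cinner p (e j) = (\<Sum>i\<in>F. if i = j then cinner x (e i) else 0)"
      unfolding p_def cinner_sum_left
    proof (intro sum.cong refl)
      fix i assume "i \<in> F"
      then have "cinner (e i) (e j) = (if i = j then 1 else 0)"
        using e j F(2) unfolding orthonormal_on_def by blast
      then show "cinner (cinner x (e i) *\<^sub>C e i) (e j) = (if i = j then cinner x (e i) else 0)"
        by (simp add: cinner_scaleC_left)
    qed
    also have "\<dots> = cinner x (e j)"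
      using j F(1) by simp
    finally show ?thesis
      by (subst cinner_eq_0_commute) (simp add: cinner_diff_left)
  qed
  moreover have "p - y \<in> complex_vector.span (e ` F)"
    unfolding p_def
    by (intro complex_vector.span_diff[OF _ y] complex_vector.span_sum complex_vector.span_scale
        complex_vector.span_base) auto
  ultimately have "cinner (p - y) (x - p) = 0"
    by - (rule orthogonal_closure_span[OF subsetD[OF closure_subset]], auto)
  then have "(norm (x - y))\<^sup>2 = (norm (p - y))\<^sup>2 + (norm (x - p))\<^sup>2"
    using norm_add_orthogonal[of "p - y" "x - p"] by simp
  then show ?thesis
    unfolding p_def[symmetric] by - (rule power2_le_imp_le, auto)
qed

text \<open>Density provides a \<open>y\<close> in the span within \<open>r\<close> of
  \<open>x\<close>, and \<open>y\<close> involves only a finite \<open>F\<close>. For every finite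
  \<open>G\<close> containing \<open>F\<close>, the partial sum over \<open>G\<close> is at least as
  close to \<open>x\<close> as \<open>y\<close>, which is convergence along finite subsets.\<close>

lemma orthonormal_expansion:
  assumes e: "orthonormal_basis_of I e S" and x: "x \<in> S"
  shows "((\<lambda>i. cinner x (e i) *\<^sub>C e i) has_sum x) I"
  unfolding has_sum_def tendsto_iff
proof (intro allI impI)
  fix r :: real assume "r > 0"
  then obtain y where y: "y \<in> complex_vector.span (e ` I)" and yx: "dist y x < r"
    using e x closure_approachable[of x "complex_vector.span (e ` I)"]
    unfolding orthonormal_basis_of_def by blast
  from y obtain t u where t: "finite t" "t \<subseteq> e ` I" and yt: "y = (\<Sum>a\<in>t. u a *\<^sub>C a)"
    unfolding complex_vector.span_explicit by blast
  from finite_subset_image[OF t] obtain F where F: "finite F" "F \<subseteq> I" "t = e ` F"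
    by blast
  have "dist (\<Sum>i\<in>G. cinner x (e i) *\<^sub>C e i) x < r" if G: "finite G" "F \<subseteq> G" "G \<subseteq> I" for G
  proof -
    have "y \<in> complex_vector.span (e ` G)"
      unfolding yt using F(3) G(2)
      by (intro complex_vector.span_sum complex_vector.span_scale complex_vector.span_base) auto
    with e G have "norm (x - (\<Sum>i\<in>G. cinner x (e i) *\<^sub>C e i)) \<le> norm (x - y)"
      by (intro orthonormal_partial_sum_best) (auto simp: orthonormal_basis_of_def)
    then show ?thesis
      using yx by (simp add: dist_norm norm_minus_commute)
  qed
  then show "\<forall>\<^sub>F G in finite_subsets_at_top I. dist (\<Sum>i\<in>G. cinner x (e i) *\<^sub>C e i) x < r"
    unfolding eventually_finite_subsets_at_top using F by blast
qed

lemma (in closed_csubspace) proj_has_sum: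
  assumes "orthonormal_basis_of I e S"
  shows "((\<lambda>i. cinner x (e i) *\<^sub>C e i) has_sum proj S x) I"
proof -
  have "((\<lambda>i. cinner (proj S x) (e i) *\<^sub>C e i) has_sum proj S x) I"
    by (rule orthonormal_expansion[OF assms proj_in])
  then show ?thesis
    by (rule has_sum_cong[THEN iffD1, rotated])
      (simp add: cinner_proj orthonormal_basis_of_in[OF assms])
qed

text \<open>Zorn's lemma gives a maximal orthonormal set \<open>B\<close> in \<open>S\<close> above
  \<open>A\<close>. If some \<open>x\<close> in \<open>S\<close> were outside its closed span
  \<open>V\<close>, the normalized difference \<open>x - proj V x\<close> could be added to
  \<open>B\<close>. Sets indexed by themselves through \<open>id\<close> avoid choosing an index
  type.\<close>

lemma (in closed_csubspace) orthonormal_extend: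
  assumes A: "A \<subseteq> S" "orthonormal_on A id"
  obtains B where "A \<subseteq> B" and "B \<subseteq> S" and "orthonormal_basis_of B id S"
proof -
  define \<A> where "\<A> = {B. A \<subseteq> B \<and> B \<subseteq> S \<and> orthonormal_on B id}"
  \<comment> \<open>Orthonormality concerns two vectors at a time, and any two vectors of the union
    already lie in one member of the chain.\<close>
  have "\<Union>\<C> \<in> \<A>" if \<C>: "\<C> \<noteq> {}" "subset.chain \<A> \<C>" for \<C>
  proof -
    have "orthonormal_on (\<Union>\<C>) id"
      unfolding orthonormal_on_def
    proof (intro ballI)
      fix i j assume "i \<in> \<Union>\<C>" "j \<in> \<Union>\<C>"
      then obtain X Y where XY: "X \<in> \<C>" "i \<in> X" "Y \<in> \<C>" "j \<in> Y"
        by (elim UnionE)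
      then have "X \<subseteq> Y \<or> Y \<subseteq> X"
        using \<C>(2) unfolding subset_chain_def by blast
      with XY obtain Z where Z: "Z \<in> \<C>" "i \<in> Z" "j \<in> Z"
        by (elim disjE) (auto dest: subsetD)
      then have "orthonormal_on Z id"
        using \<C>(2) unfolding subset_chain_def \<A>_def by blast
      with Z show "cinner (id i) (id j) = (if i = j then 1 else 0)"
        unfolding orthonormal_on_def by blast
    qed
    moreover have "A \<subseteq> \<Union>\<C>" "\<Union>\<C> \<subseteq> S"
      using \<C> unfolding subset_chain_def \<A>_def by blast+
    ultimately show ?thesis
      by (simp add: \<A>_def)
  qed
  moreover have "\<A> \<noteq> {}"
    using A by (auto simp: \<A>_def)
  ultimately obtain B where B: "B \<in> \<A>" and max: "\<And>X. X \<in> \<A> \<Longrightarrow> B \<subseteq> X \<Longrightarrow> X = B"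
    using subset_Zorn_nonempty[of \<A>] by blast
  have BS: "B \<subseteq> S" and on: "orthonormal_on B id" and AB: "A \<subseteq> B"
    using B unfolding \<A>_def by blast+
  define V where "V = closure (complex_vector.span B)"
  interpret V: closed_csubspace V
    unfolding V_def by standard (auto intro: subspace_closure complex_vector.subspace_span)
  have VS: "V \<subseteq> S"
    unfolding V_def
    by (intro closure_minimal closed complex_vector.span_minimal BS subspace)
  have BV: "B \<subseteq> V"
    unfolding V_def using closure_subset complex_vector.span_superset by blast
  have "x \<in> V" if x: "x \<in> S" for x
  proof (rule ccontr)
    assume "x \<notin> V"
    define z where "z = x - proj V x"
    define u where "u = complex_of_real (1 / norm z) *\<^sub>C z"
    have z0: "z \<noteq> 0"
      using \<open>x \<notin> V\<close> V.proj_in[of x] by (auto simp: z_def)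
    have uS: "u \<in> S"
      unfolding u_def z_def using x VS V.proj_in[of x]
      by (intro complex_vector.subspace_scale[OF subspace] complex_vector.subspace_diff[OF subspace])
        auto
    have ub: "cinner u b = 0" if "b \<in> B" for b
      using V.proj_orthogonal[of b x] BV that by (auto simp: u_def z_def cinner_scaleC_left)
    then have bu: "cinner b u = 0" if "b \<in> B" for b
      using that cinner_eq_0_commute by blast
    have uu: "cinner u u = 1"
      unfolding cinner_self using z0 by (simp add: u_def norm_scaleC norm_divide)
    have "insert u B \<in> \<A>"
      using on uS BS AB ub bu uu by (auto simp: \<A>_def orthonormal_on_def)
    then have "u \<in> B" using max by blast
    with ub[of u] uu show False by simp
  qed
  with VS have "V = S" by blast
  then show thesis
    using that[OF AB BS] on by (simp add: orthonormal_basis_of_def V_def)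
qed

section \<open>Schmidt decompositions and uniqueness of the singular values\<close>

lemma has_sum_single:
  fixes f :: "'i \<Rightarrow> 'b::{topological_comm_monoid_add, t2_space}"
  assumes "(f has_sum l) A" and "k \<in> A" and "\<And>n. n \<in> A \<Longrightarrow> n \<noteq> k \<Longrightarrow> f n = 0"
  shows "l = f k"
proof -
  have "(f has_sum f k) {k}"
    using has_sum_finite[of "{k}" f] by simp
  then have "(f has_sum f k) A"
    by (rule has_sum_cong_neutral[THEN iffD1, rotated -1]) (use assms in auto)
  with assms(1) show ?thesis
    by (rule has_sum_unique)
qed

lemma orthonormal_onD:
  "orthonormal_on I e \<Longrightarrow> i \<in> I \<Longrightarrow> j \<in> I \<Longrightarrow> cinner (e i) (e j) = (if i = j then 1 else 0)"
  unfolding orthonormal_on_def by blast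

lemma schmidt_decompositionD:
  assumes "schmidt_decomposition T K s \<xi> \<psi>"
  shows "orthonormal_on K \<xi>" and "orthonormal_on K \<psi>" and "n \<in> K \<Longrightarrow> s n > 0"
    and "((\<lambda>n. (complex_of_real (s n) * cinner x (\<xi> n)) *\<^sub>C \<psi> n) has_sum T x) K"
  using assms unfolding schmidt_decomposition_def by blast+

lemma schmidt_decomposition_apply:
  assumes D: "schmidt_decomposition T K s \<xi> \<psi>" and k: "k \<in> K"
  shows "T (\<xi> k) = complex_of_real (s k) *\<^sub>C \<psi> k"
proof -
  note \<xi> = orthonormal_onD[OF schmidt_decompositionD(1)[OF D]]
  have "T (\<xi> k) = (complex_of_real (s k) * cinner (\<xi> k) (\<xi> k)) *\<^sub>C \<psi> k"
    by (rule has_sum_single[OF schmidt_decompositionD(4)[OF D] k]) (simp add: \<xi> k)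
  then show ?thesis
    by (simp add: \<xi> k)
qed

lemma schmidt_decomposition_has_sum_cinner:
  assumes "schmidt_decomposition T K s \<xi> \<psi>"
  shows "((\<lambda>n. complex_of_real (s n) * cinner x (\<xi> n) * cinner (\<psi> n) y) has_sum cinner (T x) y) K"
proof -
  from has_sum_bounded_linear[OF bounded_linear_cinner_left schmidt_decompositionD(4)[OF assms]]
  show ?thesis
    by (simp only: cinner_scaleC_left)
qed

text \<open>Adjoint-free form of the relation that the adjoint of \<open>T\<close> sends
  \<open>\<psi> k\<close> to \<open>s k\<close> times \<open>\<xi> k\<close>; orthonormality of
  \<psi> leaves a single term of the series.\<close>

lemma schmidt_decomposition_cinner:
  assumes D: "schmidt_decomposition T K s \<xi> \<psi>" and k: "k \<in> K"
  shows "cinner (T x) (\<psi> k) = complex_of_real (s k) * cinner x (\<xi> k)"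
proof -
  note \<psi> = orthonormal_onD[OF schmidt_decompositionD(2)[OF D]]
  have "cinner (T x) (\<psi> k) = complex_of_real (s k) * cinner x (\<xi> k) * cinner (\<psi> k) (\<psi> k)"
    by (rule has_sum_single[OF schmidt_decomposition_has_sum_cinner[OF D] k]) (simp add: \<psi> k)
  then show ?thesis
    by (simp add: \<psi> k)
qed

lemma schmidt_decomposition_eq_0:
  assumes D: "schmidt_decomposition T K s \<xi> \<psi>" and "\<And>n. n \<in> K \<Longrightarrow> cinner x (\<xi> n) = 0"
  shows "T x = 0"
proof -
  have "((\<lambda>n. (complex_of_real (s n) * cinner x (\<xi> n)) *\<^sub>C \<psi> n) has_sum 0) K"
    by (rule has_sum_0) (simp add: assms(2))
  with schmidt_decompositionD(4)[OF D] show ?thesis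
    by (rule has_sum_unique)
qed

text \<open>
  If \<open>\<sigma> = t k\<close> differs from every \<open>s n\<close>, then \<open>T\<^sup>* T\<close> has orthogonal eigenvectors \<open>\<xi>' k\<close> and \<open>\<xi> n\<close>,
  so the first decomposition kills \<open>\<xi>' k\<close>. The adjoint is avoided by comparing the two ways of
  computing \<open>\<langle>T (\<xi>' k), \<psi> n\<rangle>\<close> and \<open>\<langle>T (\<xi> n), \<psi>' k\<rangle>\<close>.
\<close>

lemma schmidt_decomposition_values_subset:
  assumes D: "schmidt_decomposition T K s \<xi> \<psi>" and D': "schmidt_decomposition T L t \<xi>' \<psi>'"
  shows "t ` L \<subseteq> s ` K"
proof (rule ccontr)
  assume "\<not> ?thesis"
  then obtain k where k: "k \<in> L" and ne: "\<And>n. n \<in> K \<Longrightarrow> s n \<noteq> t k" by force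
  have tk: "t k > 0"
    using D' k by (rule schmidt_decompositionD(3))
  have "cinner (\<xi>' k) (\<xi> n) = 0" if n: "n \<in> K" for n
  proof -
    have sn: "s n > 0"
      using D n by (rule schmidt_decompositionD(3))
    have 1: "of_real (t k) * cinner (\<psi>' k) (\<psi> n) = of_real (s n) * cinner (\<xi>' k) (\<xi> n)"
      using schmidt_decomposition_cinner[OF D n, of "\<xi>' k"] schmidt_decomposition_apply[OF D' k]
      by (simp add: cinner_scaleC_left)
    have "cnj (of_real (s n) * cinner (\<psi> n) (\<psi>' k)) = cnj (of_real (t k) * cinner (\<xi> n) (\<xi>' k))"
      using schmidt_decomposition_cinner[OF D' k, of "\<xi> n"] schmidt_decomposition_apply[OF D n]
      by (simp add: cinner_scaleC_left)
    then have 2: "of_real (s n) * cinner (\<psi>' k) (\<psi> n) = of_real (t k) * cinner (\<xi>' k) (\<xi> n)"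
      unfolding complex_cnj_mult cinner_commute[symmetric] by simp
    have "complex_of_real ((s n)\<^sup>2) * cinner (\<xi>' k) (\<xi> n)
        = of_real (s n) * (of_real (t k) * cinner (\<psi>' k) (\<psi> n))"
      unfolding 1 by (simp add: power2_eq_square)
    also have "\<dots> = of_real (t k) * (of_real (s n) * cinner (\<psi>' k) (\<psi> n))"
      by (rule mult.left_commute)
    also have "\<dots> = complex_of_real ((t k)\<^sup>2) * cinner (\<xi>' k) (\<xi> n)"
      unfolding 2 by (simp add: power2_eq_square)
    finally have "complex_of_real ((s n)\<^sup>2) * cinner (\<xi>' k) (\<xi> n)
        = complex_of_real ((t k)\<^sup>2) * cinner (\<xi>' k) (\<xi> n)" .
    moreover have "(s n)\<^sup>2 \<noteq> (t k)\<^sup>2"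
      using ne[OF n] sn tk by simp
    ultimately show ?thesis
      by (metis mult_cancel_right of_real_eq_iff)
  qed
  then have "complex_of_real (t k) *\<^sub>C \<psi>' k = 0"
    using schmidt_decomposition_eq_0[OF D] schmidt_decomposition_apply[OF D' k] by simp
  moreover have "cinner (\<psi>' k) (\<psi>' k) = 1"
    using orthonormal_onD[OF schmidt_decompositionD(2)[OF D'] k k] by simp
  ultimately show False
    using tk by auto
qed

text \<open>One inclusion compares the given decomposition with an arbitrary other one. For the
  other, the given one is re-indexed by its own vectors \<open>\<xi> n\<close>, since
  \<open>singular_values\<close> takes index sets inside the space.\<close>

lemma singular_values_eq:
  fixes T :: "'a::complex_inner \<Rightarrow> 'a"
  assumes D: "schmidt_decomposition T K s \<xi> \<psi>"
  shows "singular_values T = s ` K"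
proof
  show "singular_values T \<subseteq> s ` K"
    unfolding singular_values_def using schmidt_decomposition_values_subset[OF D] by blast
  have inj: "inj_on \<xi> K"
    by (intro orthonormal_on_inj_on schmidt_decompositionD(1)[OF D])
  then have "bij_betw (inv_into K \<xi>) (\<xi> ` K) K"
    by (simp add: bij_betw_inv_into inj_on_imp_bij_betw)
  note D' = schmidt_decomposition_reindex[OF this D]
  have "(s \<circ> inv_into K \<xi>) ` \<xi> ` K = s ` K"
    using inj by (force simp: image_image)
  with D' show "s ` K \<subseteq> singular_values T"
    unfolding singular_values_def by blast
qed

section \<open>Passing between biorthogonal bases and Schmidt decompositions\<close>

lemma schmidt_decomposition_of_bases:
  fixes S T :: "'h::chilbert_space set"
  assumes "closed_csubspace S" and "closed_csubspace T"
    and \<psi>: "orthonormal_basis_of I \<psi> S" and \<xi>: "orthonormal_basis_of J \<xi> T"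
    and orth: "\<And>n m. n \<in> J \<Longrightarrow> m \<in> I \<Longrightarrow> n \<noteq> m \<Longrightarrow> cinner (\<xi> n) (\<psi> m) = 0"
  defines "N \<equiv> {n \<in> I \<inter> J. cinner (\<xi> n) (\<psi> n) \<noteq> 0}"
  shows "schmidt_decomposition (proj S \<circ> proj T) N (\<lambda>n. cmod (cinner (\<xi> n) (\<psi> n))) \<xi>
    (\<lambda>n. sgn (cinner (\<xi> n) (\<psi> n)) *\<^sub>C \<psi> n)"
proof -
  interpret S: closed_csubspace S by fact
  interpret T: closed_csubspace T by fact
  have sum: "((\<lambda>n. cinner x (\<xi> n) * cinner (\<xi> n) (\<psi> m)) has_sum cinner (proj T x) (\<psi> m)) J" for x m
    using has_sum_bounded_linear[OF bounded_linear_cinner_left T.proj_has_sum[OF \<xi>]]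
    by (simp only: cinner_scaleC_left)
  \<comment> \<open>In the expansion of \<open>proj T x\<close> along \<xi>, biorthogonality leaves
    at most the term \<open>n = m\<close> when paired with \<open>\<psi> m\<close>. For
    \<open>m\<close> in \<open>I - N\<close> even that term is absent or zero.\<close>
  have in_N: "cinner (proj T x) (\<psi> m) = cinner x (\<xi> m) * cinner (\<xi> m) (\<psi> m)" if "m \<in> N" for x m
    using sum by (rule has_sum_single) (use that orth in \<open>auto simp: N_def\<close>)
  have not_N: "cinner (proj T x) (\<psi> m) = 0" if "m \<in> I - N" for x m
  proof -
    have "cinner (\<xi> n) (\<psi> m) = 0" if "n \<in> J" for n
      using that \<open>m \<in> I - N\<close> orth by (cases "n = m") (auto simp: N_def)
    then have "((\<lambda>n. cinner x (\<xi> n) * cinner (\<xi> n) (\<psi> m)) has_sum 0) J"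
      by (intro has_sum_0) simp
    with sum show ?thesis
      by (rule has_sum_unique)
  qed
  \<comment> \<open>This is the expansion of \<open>proj S (proj T x)\<close> along \<psi>,
    restricted from \<open>I\<close> to \<open>N\<close>, where the other terms vanish. On
    \<open>N\<close> the coefficient is rewritten as modulus times phase.\<close>
  have "((\<lambda>n. (complex_of_real (cmod (cinner (\<xi> n) (\<psi> n))) * cinner x (\<xi> n)) *\<^sub>C
      sgn (cinner (\<xi> n) (\<psi> n)) *\<^sub>C \<psi> n) has_sum proj S (proj T x)) N" for x
    using S.proj_has_sum[OF \<psi>, of "proj T x"]
    by (rule has_sum_cong_neutral[THEN iffD1, rotated -1])
      (auto simp: not_N in_N scaleC_scaleC sgn_eq N_def mult.commute)
  moreover have "orthonormal_on N (\<lambda>n. sgn (cinner (\<xi> n) (\<psi> n)) *\<^sub>C \<psi> n)"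
  proof -
    \<comment> \<open>The phases have modulus 1 and so preserve orthonormality; \<open>N\<close>
      excludes \<open>c = 0\<close>, where \<open>sgn\<close> would be 0.\<close>
    have "cnj (sgn c) * sgn c = 1" if "c \<noteq> 0" for c
      using that complex_norm_square[of "sgn c"] by (simp add: norm_sgn mult.commute)
    then show ?thesis
      using \<psi> by (auto simp: orthonormal_on_def orthonormal_basis_of_def N_def cinner_scaleC_left
          cinner_scaleC_right)
  qed
  moreover have "orthonormal_on N \<xi>"
    using \<xi> by (auto simp: orthonormal_on_def orthonormal_basis_of_def N_def)
  ultimately show ?thesis
    unfolding schmidt_decomposition_def by (simp add: N_def)
qed

lemma bases_of_schmidt_decomposition:
  fixes S T :: "'h::chilbert_space set"
  assumes "closed_csubspace S" and "closed_csubspace T"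
    and D: "schmidt_decomposition (proj S \<circ> proj T) K s \<xi> \<psi>"
  obtains I J :: "'h set" and \<psi>' \<xi>'
  where "orthonormal_basis_of I \<psi>' S" and "orthonormal_basis_of J \<xi>' T"
    and "\<And>n m. n \<in> J \<Longrightarrow> m \<in> I \<Longrightarrow> n \<noteq> m \<Longrightarrow> cinner (\<xi>' n) (\<psi>' m) = 0"
proof -
  interpret S: closed_csubspace S by fact
  interpret T: closed_csubspace T by fact
  have s: "s n > 0" if "n \<in> K" for n
    using D that by (rule schmidt_decompositionD(3))
  have on\<xi>: "orthonormal_on K \<xi>" and on\<psi>: "orthonormal_on K \<psi>"
    using schmidt_decompositionD[OF D] by blast+
  \<comment> \<open>The part \<open>x\<close> of \<open>\<xi> n\<close> orthogonal to
    \<open>T\<close> is killed by the product, hence orthogonal to \<open>\<xi> n\<close> because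
    \<open>s n\<close> is nonzero. Being orthogonal to \<open>proj T (\<xi> n)\<close> as well, it
    is orthogonal to itself.\<close>
  have \<xi>T: "\<xi> n \<in> T" if n: "n \<in> K" for n
  proof -
    define x where "x = \<xi> n - proj T (\<xi> n)"
    have xT: "cinner x z = 0" if "z \<in> T" for z
      using T.proj_orthogonal[OF that] by (simp add: x_def)
    then have "(proj S \<circ> proj T) x = 0"
      using T.proj_eq_0_iff[of x] S.proj_id[OF complex_vector.subspace_0[OF S.subspace]] by simp
    then have "cinner x (\<xi> n) = 0"
      using schmidt_decomposition_cinner[OF D n, of x] s[OF n] by simp
    then have "cinner x x = 0"
      using xT[OF T.proj_in[of "\<xi> n"]] by (subst (2) x_def) (simp add: cinner_diff_right)
    then show ?thesis
      using T.proj_in[of "\<xi> n"] by (simp add: x_def)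
  qed
  have \<psi>S: "\<psi> n \<in> S" if n: "n \<in> K" for n
  proof -
    have "\<psi> n = complex_of_real (1 / s n) *\<^sub>C complex_of_real (s n) *\<^sub>C \<psi> n"
      using s[OF n] by (simp add: scaleC_scaleC flip: of_real_mult)
    also have "\<dots> = complex_of_real (1 / s n) *\<^sub>C proj S (proj T (\<xi> n))"
      using schmidt_decomposition_apply[OF D n] by simp
    also have "\<dots> \<in> S"
      by (intro complex_vector.subspace_scale[OF S.subspace] S.proj_in)
    finally show ?thesis .
  qed
  \<comment> \<open>\<open>proj T\<close> fixes \<open>x\<close>, and \<open>proj S\<close> is
    invisible when paired with \<open>y\<close>. Thus inner products between \<open>T\<close> and
    \<open>S\<close> are governed by the Schmidt series.\<close>
  have cinner_comp: "cinner x y = cinner ((proj S \<circ> proj T) x) y" if "x \<in> T" "y \<in> S" for x y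
    using that by (simp add: T.proj_id S.cinner_proj)
  have T_orth: "cinner x y = 0" if "x \<in> T" "y \<in> S" "\<And>n. n \<in> K \<Longrightarrow> cinner x (\<xi> n) = 0" for x y
    using cinner_comp[OF that(1,2)] schmidt_decomposition_eq_0[OF D that(3)] by simp
  have S_orth: "cinner x y = 0" if "x \<in> T" "y \<in> S" "\<And>n. n \<in> K \<Longrightarrow> cinner (\<psi> n) y = 0" for x y
  proof -
    have "((\<lambda>n. complex_of_real (s n) * cinner x (\<xi> n) * cinner (\<psi> n) y) has_sum 0) K"
      by (intro has_sum_0) (simp add: that(3))
    from has_sum_unique[OF schmidt_decomposition_has_sum_cinner[OF D] this] show ?thesis
      using cinner_comp[OF that(1,2)] by simp
  qed
  have \<xi>\<psi>: "cinner (\<xi> n) (\<psi> m) = 0" if "n \<in> K" "m \<in> K" "n \<noteq> m" for n m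
    using cinner_comp[OF \<xi>T \<psi>S] schmidt_decomposition_apply[OF D] on\<psi> that
    by (simp add: cinner_scaleC_left orthonormal_on_def)
  \<comment> \<open>Turns families over \<open>K\<close> into sets indexed by themselves, the form
    that \<open>orthonormal_extend\<close> expects.\<close>
  have on_image: "orthonormal_on (e ` K) id" if "orthonormal_on K e" for e :: "_ \<Rightarrow> 'h"
    using that orthonormal_on_inj_on[OF that] by (auto simp: orthonormal_on_def inj_on_eq_iff)
  obtain J where J: "\<xi> ` K \<subseteq> J" "J \<subseteq> T" "orthonormal_basis_of J id T"
    using T.orthonormal_extend[OF _ on_image[OF on\<xi>]] \<xi>T by blast
  obtain D' where D': "\<psi> ` K \<subseteq> D'" "D' \<subseteq> S" "orthonormal_basis_of D' id S"
    using S.orthonormal_extend[OF _ on_image[OF on\<psi>]] \<psi>S by blast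
  define C where "C = D' - \<psi> ` K"
  have onD': "orthonormal_on D' id" and onJ: "orthonormal_on J id"
    using D'(3) J(3) by (auto simp: orthonormal_basis_of_def)
  have C_orth: "cinner x c = 0" if "x \<in> T" "c \<in> C" for x c
  proof (rule S_orth)
    show "c \<in> S" using that D'(2) by (auto simp: C_def)
    fix n assume "n \<in> K"
    then have "\<psi> n \<in> D'" "\<psi> n \<noteq> c" "c \<in> D'"
      using that D'(1) by (auto simp: C_def)
    then show "cinner (\<psi> n) c = 0"
      using orthonormal_onD[OF onD', of "\<psi> n" c] by simp
  qed (use that in simp)
  \<comment> \<open>A unit vector \<open>c\<close> in \<open>T\<close> would be orthogonal to itself
    by \<open>C_orth\<close>. Hence \<open>C\<close> is disjoint from the image of \<xi>, and the
    two kinds of indices in \<open>I\<close> cannot clash.\<close>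
  have C_T: "c \<notin> T" if "c \<in> C" for c
    using C_orth[of c c] that orthonormal_onD[OF onD', of c c] by (auto simp: C_def)
  have J_orth: "cinner x y = 0" if "x \<in> J - \<xi> ` K" "y \<in> S" for x y
  proof (rule T_orth)
    show "x \<in> T" using that J(2) by auto
    fix n assume "n \<in> K"
    then have "\<xi> n \<in> J" "x \<noteq> \<xi> n" "x \<in> J"
      using that J(1) by auto
    then show "cinner x (\<xi> n) = 0"
      using orthonormal_onD[OF onJ, of x "\<xi> n"] by simp
  qed (use that in simp)
  have inj\<xi>: "inj_on \<xi> K"
    using on\<xi> by (rule orthonormal_on_inj_on)
  \<comment> \<open>Both bases need indices in the space: \<open>\<psi> n\<close> is indexed by \<open>\<xi> n\<close>, every other vector by itself.\<close>
  define \<psi>' where "\<psi>' = (\<lambda>x. if x \<in> C then x else \<psi> (inv_into K \<xi> x))"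
  have \<psi>'\<xi>: "\<psi>' (\<xi> n) = \<psi> n" if "n \<in> K" for n
    using that C_T \<xi>T inj\<xi> by (auto simp: \<psi>'_def)
  have \<psi>'C: "\<psi>' c = c" if "c \<in> C" for c
    using that by (simp add: \<psi>'_def)
  define I where "I = \<xi> ` K \<union> C"
  have image\<xi>: "\<psi>' ` \<xi> ` K = \<psi> ` K" and imageC: "\<psi>' ` C = C"
    by (simp_all add: image_image \<psi>'\<xi> \<psi>'C)
  have image: "\<psi>' ` I = D'"
    unfolding I_def image_Un image\<xi> imageC using D'(1) by (auto simp: C_def)
  have inj: "inj_on \<psi>' I"
    unfolding I_def inj_on_Un
  proof (intro conjI)
    have "inj_on (\<psi>' \<circ> \<xi>) K"
      using orthonormal_on_inj_on[OF on\<psi>] by (simp add: \<psi>'\<xi> cong: inj_on_cong)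
    then show "inj_on \<psi>' (\<xi> ` K)"
      by (rule inj_on_imageI)
    show "inj_on \<psi>' C"
      by (rule inj_onI) (simp add: \<psi>'C)
    have "\<psi>' ` \<xi> ` K \<inter> \<psi>' ` C = {}"
      unfolding image\<xi> imageC by (auto simp: C_def)
    then show "\<psi>' ` (\<xi> ` K - C) \<inter> \<psi>' ` (C - \<xi> ` K) = {}"
      by blast
  qed
  have "orthonormal_on I \<psi>'"
    unfolding orthonormal_on_def
  proof (intro ballI)
    fix i j assume ij: "i \<in> I" "j \<in> I"
    then have "\<psi>' i \<in> D'" "\<psi>' j \<in> D'"
      using image by blast+
    then show "cinner (\<psi>' i) (\<psi>' j) = (if i = j then 1 else 0)"
      using orthonormal_onD[OF onD'] inj_on_eq_iff[OF inj ij] by simp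
  qed
  then have "orthonormal_basis_of I \<psi>' S"
    using D'(3) by (simp add: orthonormal_basis_of_def image)
  \<comment> \<open>If \<open>m\<close> is in \<open>C\<close>, then \<open>C_orth\<close> applies.
    Otherwise \<open>\<psi>' m\<close> is some \<open>\<psi> k\<close>: \<open>J_orth\<close>
    handles an added vector \<open>n\<close>, and \<open>\<xi>\<psi>\<close> handles
    \<open>n\<close> among the \<xi>, where \<open>n \<noteq> m\<close> gives distinct indices in
    \<open>K\<close>.\<close>
  moreover have "cinner (id n) (\<psi>' m) = 0" if n: "n \<in> J" and m: "m \<in> I" and "n \<noteq> m" for n m
  proof (cases "m \<in> C")
    case True
    then show ?thesis using C_orth J(2) n by (auto simp: \<psi>'C)
  next
    case False
    then obtain k where k: "k \<in> K" "m = \<xi> k"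
      using m by (auto simp: I_def)
    show ?thesis
      using J_orth[of n "\<psi> k"] \<xi>\<psi>[of _ k] n k \<open>n \<noteq> m\<close> \<psi>S
      by (cases "n \<in> \<xi> ` K") (auto simp: \<psi>'\<xi>)
  qed
  ultimately show thesis
    using that J(3) by blast
qed

theorem theorem2p1:
  fixes S T :: "'h::chilbert_space set"
  assumes "complex_vector.subspace S" and "closed S"
    and "complex_vector.subspace T" and "closed T"
  shows "(S_decomposable (proj S \<circ> proj T) \<longleftrightarrow>
      (\<exists>(I::'h set) (J::'h set) \<psi> \<xi>.
        orthonormal_basis_of I \<psi> S \<and> orthonormal_basis_of J \<xi> T \<and>
        (\<forall>n\<in>J. \<forall>m\<in>I. n \<noteq> m \<longrightarrow> cinner (\<xi> n) (\<psi> m) = 0))) \<and>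
    (\<forall>(I::'i set) (J::'i set) \<psi> \<xi>.
        orthonormal_basis_of I \<psi> S \<and> orthonormal_basis_of J \<xi> T \<and>
        (\<forall>n\<in>J. \<forall>m\<in>I. n \<noteq> m \<longrightarrow> cinner (\<xi> n) (\<psi> m) = 0) \<longrightarrow>
        (let N = {n \<in> I \<inter> J. cinner (\<xi> n) (\<psi> n) \<noteq> 0};
             s = (\<lambda>n. cmod (cinner (\<xi> n) (\<psi> n)))
         in singular_values (proj S \<circ> proj T) = s ` N \<and>
            (\<exists>\<xi>' \<psi>'. schmidt_decomposition (proj S \<circ> proj T) N s \<xi>' \<psi>')))"
proof (intro conjI allI impI iffI)
  have S: "closed_csubspace S" and T: "closed_csubspace T"
    using assms by (auto simp: closed_csubspace_def)
  note of_bases = schmidt_decomposition_of_bases[OF S T]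
  {
    assume "S_decomposable (proj S \<circ> proj T)"
    then obtain K :: "'h set" and s \<xi> \<psi>
      where "schmidt_decomposition (proj S \<circ> proj T) K s \<xi> \<psi>"
      unfolding S_decomposable_def by blast
    then show "\<exists>(I::'h set) (J::'h set) \<psi> \<xi>.
        orthonormal_basis_of I \<psi> S \<and> orthonormal_basis_of J \<xi> T \<and>
        (\<forall>n\<in>J. \<forall>m\<in>I. n \<noteq> m \<longrightarrow> cinner (\<xi> n) (\<psi> m) = 0)"
      by (rule bases_of_schmidt_decomposition[OF S T]) blast
  next
    assume "\<exists>(I::'h set) (J::'h set) \<psi> \<xi>.
        orthonormal_basis_of I \<psi> S \<and> orthonormal_basis_of J \<xi> T \<and>
        (\<forall>n\<in>J. \<forall>m\<in>I. n \<noteq> m \<longrightarrow> cinner (\<xi> n) (\<psi> m) = 0)"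
    then obtain I J :: "'h set" and \<psi> \<xi>
      where "orthonormal_basis_of I \<psi> S" "orthonormal_basis_of J \<xi> T"
        and "\<And>n m. n \<in> J \<Longrightarrow> m \<in> I \<Longrightarrow> n \<noteq> m \<Longrightarrow> cinner (\<xi> n) (\<psi> m) = 0"
      by blast
    note D = of_bases[OF this]
    have "bounded_clinear (proj S \<circ> proj T)"
      using closed_csubspace.bounded_clinear_proj[OF S] closed_csubspace.bounded_clinear_proj[OF T]
      by (auto simp: bounded_clinear_def o_def intro: bounded_linear_compose)
    then show "S_decomposable (proj S \<circ> proj T)"
      using D by (rule S_decomposableI)
  next
    \<comment> \<open>The index type is now arbitrary, which is harmless because
      \<open>singular_values_eq\<close> accepts a decomposition over any index type.\<close>
    fix I J :: "'i set" and \<psi> \<xi>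
    assume "orthonormal_basis_of I \<psi> S \<and> orthonormal_basis_of J \<xi> T \<and>
      (\<forall>n\<in>J. \<forall>m\<in>I. n \<noteq> m \<longrightarrow> cinner (\<xi> n) (\<psi> m) = 0)"
    then have "orthonormal_basis_of I \<psi> S" "orthonormal_basis_of J \<xi> T"
      and "\<And>n m. n \<in> J \<Longrightarrow> m \<in> I \<Longrightarrow> n \<noteq> m \<Longrightarrow> cinner (\<xi> n) (\<psi> m) = 0"
      by auto
    note D = of_bases[OF this]
    show "let N = {n \<in> I \<inter> J. cinner (\<xi> n) (\<psi> n) \<noteq> 0};
             s = (\<lambda>n. cmod (cinner (\<xi> n) (\<psi> n)))
         in singular_values (proj S \<circ> proj T) = s ` N \<and>
            (\<exists>\<xi>' \<psi>'. schmidt_decomposition (proj S \<circ> proj T) N s \<xi>' \<psi>')"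
      unfolding Let_def using singular_values_eq[OF D] D by blast
  }
qed

end
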